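(* Let $A/B$ be an ideal associative ring extension satisfying the following three conditions (or the conditions obtained from them by replacing "left" by "right" in (i) and "right" by "left" in (ii)): (i) $B$ is a direct summand of $A$ as a left $B$-module; (ii) every ideal of $B$ has the identity property as a right $B$-module; (iii) $A$ is simple. Then $B$ is $A$-simple.
   Context: Rings are neither necessarily associative nor necessarily unital. A ring extension $A/B$ means that $A$ and $B$ are rings with $B$ a subring of $A$. Ideals are two-sided. A ring is simple if it has no ideals other than $\{0\}$ and itself. For subsets $X,Y$ of $A$, $XY$ denotes the set of all finite sums of products $xy$ with $x\in X$, $y\in Y$. A left (right) $B$-module $X$ has the identity property if $BX=X$ (respectively $XB=X$). An ideal $I$ of $B$ is $A$-invariant if $AI\subseteq IA$. $B$ (or $A/B$) is $A$-simple if there is no non-trivial $A$-invariant ideal of $B$, i.e. none other than $\{0\}$ and $B$. The extension $A/B$ is ideal associative if any ideal $I$ of $B$ associates with any finite collection of copies of $A$, i.e. in any product of $I$ with finitely many copies of $A$, written in a given order, all ways of inserting parentheses give the same set; for instance with two copies of $A$: $(IA)A=I(AA)$, $(AI)A=A(IA)$ and $(AA)I=A(AI)$.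
   Formalization: For the parenthetical conditions with left and right exchanged, the conclusion is the dual of A-simplicity (no non-trivial ideal I of B with IA ⊆ AI); with AI ⊆ IA that case is false, e.g. A = M_3(k), B = span{E11, E12, E22+E33}, I = span{E12, E22+E33}. *)

theory Defs
  imports "HOL-Algebra.Ideal_Product" "HOL-Algebra.AbelCoset"
begin

text \<open>Rings here are neither necessarily associative nor necessarily unital. They are carried by the
  library's ring records; the field \<open>one\<close> of the record is not constrained and never used.\<close>

locale nonassoc_ring = abelian_group R for R (structure) +
  assumes mult_closed: "\<lbrakk>x \<in> carrier R; y \<in> carrier R\<rbrakk> \<Longrightarrow> x \<otimes> y \<in> carrier R"
    and distrib_right:
      "\<lbrakk>x \<in> carrier R; y \<in> carrier R; z \<in> carrier R\<rbrakk> \<Longrightarrow> (x \<oplus> y) \<otimes> z = x \<otimes> z \<oplus> y \<otimes> z"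
    and distrib_left:
      "\<lbrakk>x \<in> carrier R; y \<in> carrier R; z \<in> carrier R\<rbrakk> \<Longrightarrow> z \<otimes> (x \<oplus> y) = z \<otimes> x \<oplus> z \<otimes> y"

locale nonassoc_ring_extension = nonassoc_ring A for A (structure) and B +
  assumes subring_additive: "additive_subgroup B A"
    and subring_mult: "\<lbrakk>x \<in> B; y \<in> B\<rbrakk> \<Longrightarrow> x \<otimes> y \<in> B"

text \<open>The product \<open>XY\<close>, the set of finite sums of products \<open>xy\<close>, is the library's
  \<^const>\<open>ideal_prod\<close>, whose definition makes sense for arbitrary subsets. It generates only
  nonempty sums, which is immaterial for sets containing zero.\<close>

text \<open>\<open>nonassoc_ideal A B I\<close>: \<open>I\<close> is a two-sided ideal of the subring \<open>B\<close> of \<open>A\<close>.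
  The ideals of \<open>A\<close> itself are obtained by taking \<open>carrier A\<close> for \<open>B\<close>.\<close>

definition nonassoc_ideal :: "('a, 'm) ring_scheme \<Rightarrow> 'a set \<Rightarrow> 'a set \<Rightarrow> bool" where
  "nonassoc_ideal A B I \<longleftrightarrow>
     additive_subgroup I A \<and> I \<subseteq> B \<and>
     (\<forall>b\<in>B. \<forall>x\<in>I. b \<otimes>\<^bsub>A\<^esub> x \<in> I \<and> x \<otimes>\<^bsub>A\<^esub> b \<in> I)"

definition simple_nonassoc_ring :: "('a, 'm) ring_scheme \<Rightarrow> bool" where
  "simple_nonassoc_ring A \<longleftrightarrow>
     (\<forall>I. nonassoc_ideal A (carrier A) I \<longrightarrow> I = {\<zero>\<^bsub>A\<^esub>} \<or> I = carrier A)"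

definition invariant_ideal :: "('a, 'm) ring_scheme \<Rightarrow> 'a set \<Rightarrow> 'a set \<Rightarrow> bool" where
  "invariant_ideal A B I \<longleftrightarrow>
     nonassoc_ideal A B I \<and> ideal_prod A (carrier A) I \<subseteq> ideal_prod A I (carrier A)"

definition extension_simple :: "('a, 'm) ring_scheme \<Rightarrow> 'a set \<Rightarrow> bool" where
  "extension_simple A B \<longleftrightarrow> (\<forall>I. invariant_ideal A B I \<longrightarrow> I = {\<zero>\<^bsub>A\<^esub>} \<or> I = B)"

text \<open>The left-right duals of the previous two notions, that is, the same notions for the extension
  of opposite rings. The inclusion \<open>AI \<subseteq> IA\<close> is not symmetric, so they are different notions. Hypotheses on the left and right module structures
  that are mirrored go with these dual notions: for the subring \<open>B\<close> of the 3 by 3 matrices over a field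
  spanned by \<open>E11\<close>, \<open>E12\<close> and \<open>E22 + E33\<close>, the ideal \<open>I\<close> spanned by the last two satisfies \<open>IA = A\<close>,
  although \<open>B\<close> is unital and a direct summand as a right \<open>B\<close>-module.\<close>

definition op_invariant_ideal :: "('a, 'm) ring_scheme \<Rightarrow> 'a set \<Rightarrow> 'a set \<Rightarrow> bool" where
  "op_invariant_ideal A B I \<longleftrightarrow>
     nonassoc_ideal A B I \<and> ideal_prod A I (carrier A) \<subseteq> ideal_prod A (carrier A) I"

definition op_extension_simple :: "('a, 'm) ring_scheme \<Rightarrow> 'a set \<Rightarrow> bool" where
  "op_extension_simple A B \<longleftrightarrow> (\<forall>I. op_invariant_ideal A B I \<longrightarrow> I = {\<zero>\<^bsub>A\<^esub>} \<or> I = B)"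

text \<open>Sub-modules of \<open>A\<close> for the action of \<open>B\<close> by multiplication. No associativity of the action
  is required, in accordance with the rings being non-associative.\<close>

definition left_submodule :: "('a, 'm) ring_scheme \<Rightarrow> 'a set \<Rightarrow> 'a set \<Rightarrow> bool" where
  "left_submodule A B X \<longleftrightarrow> additive_subgroup X A \<and> (\<forall>b\<in>B. \<forall>x\<in>X. b \<otimes>\<^bsub>A\<^esub> x \<in> X)"

definition right_submodule :: "('a, 'm) ring_scheme \<Rightarrow> 'a set \<Rightarrow> 'a set \<Rightarrow> bool" where
  "right_submodule A B X \<longleftrightarrow> additive_subgroup X A \<and> (\<forall>b\<in>B. \<forall>x\<in>X. x \<otimes>\<^bsub>A\<^esub> b \<in> X)"

definition left_direct_summand :: "('a, 'm) ring_scheme \<Rightarrow> 'a set \<Rightarrow> 'a set \<Rightarrow> bool" where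
  "left_direct_summand A B X \<longleftrightarrow>
     left_submodule A B X \<and>
     (\<exists>C. left_submodule A B C \<and> X \<inter> C = {\<zero>\<^bsub>A\<^esub>} \<and> X <+>\<^bsub>A\<^esub> C = carrier A)"

definition right_direct_summand :: "('a, 'm) ring_scheme \<Rightarrow> 'a set \<Rightarrow> 'a set \<Rightarrow> bool" where
  "right_direct_summand A B X \<longleftrightarrow>
     right_submodule A B X \<and>
     (\<exists>C. right_submodule A B C \<and> X \<inter> C = {\<zero>\<^bsub>A\<^esub>} \<and> X <+>\<^bsub>A\<^esub> C = carrier A)"

definition left_identity_property :: "('a, 'm) ring_scheme \<Rightarrow> 'a set \<Rightarrow> 'a set \<Rightarrow> bool" where
  "left_identity_property A B X \<longleftrightarrow> ideal_prod A B X = X"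

definition right_identity_property :: "('a, 'm) ring_scheme \<Rightarrow> 'a set \<Rightarrow> 'a set \<Rightarrow> bool" where
  "right_identity_property A B X \<longleftrightarrow> ideal_prod A X B = X"

text \<open>A bracketing is a nonempty word of sets together with a way of inserting parentheses.\<close>

datatype 'a bracketing = Factor "'a set" | Product "'a bracketing" "'a bracketing"

primrec factors :: "'a bracketing \<Rightarrow> 'a set list" where
  "factors (Factor X) = [X]"
| "factors (Product s t) = factors s @ factors t"

primrec bracketing_prod :: "('a, 'm) ring_scheme \<Rightarrow> 'a bracketing \<Rightarrow> 'a set" where
  "bracketing_prod A (Factor X) = X"
| "bracketing_prod A (Product s t) = ideal_prod A (bracketing_prod A s) (bracketing_prod A t)"

definition ideal_associative :: "('a, 'm) ring_scheme \<Rightarrow> 'a set \<Rightarrow> bool" where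
  "ideal_associative A B \<longleftrightarrow>
     (\<forall>I. nonassoc_ideal A B I \<longrightarrow>
       (\<forall>m n s t. factors s = replicate m (carrier A) @ [I] @ replicate n (carrier A) \<and>
                  factors t = replicate m (carrier A) @ [I] @ replicate n (carrier A) \<longrightarrow>
                  bracketing_prod A s = bracketing_prod A t))"

end

theory Submission
  imports Defs
begin

text \<open>If \<open>I\<close> is an \<open>A\<close>-invariant ideal of \<open>B\<close>, then \<open>(IA)A = I(AA) \<subseteq> IA\<close> and
  \<open>A(IA) = (AI)A \<subseteq> (IA)A \<subseteq> IA\<close>, so \<open>IA\<close> is an ideal of \<open>A\<close> containing \<open>I = IB\<close>. Unless \<open>I\<close> is
  zero, simplicity gives \<open>IA = A\<close>. Writing \<open>A = B \<oplus> C\<close> as left \<open>B\<close>-modules,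
  \<open>B \<subseteq> IA = IB + IC \<subseteq> I + C\<close>, and \<open>B \<inter> C = 0\<close> forces \<open>B = I\<close>. The other half is the same
  statement for the opposite rings.\<close>

lemma ideal_prod_mono:
  assumes "X \<subseteq> X'" "Y \<subseteq> Y'"
  shows "ideal_prod A X Y \<subseteq> ideal_prod A X' Y'"
proof
  fix z assume "z \<in> ideal_prod A X Y"
  then show "z \<in> ideal_prod A X' Y'"
    by induction (use assms in \<open>auto intro: ideal_prod.intros\<close>)
qed

lemma ideal_prod_subsetI:
  assumes "additive_subgroup Z A"
    and "\<And>x y. x \<in> X \<Longrightarrow> y \<in> Y \<Longrightarrow> x \<otimes>\<^bsub>A\<^esub> y \<in> Z"
  shows "ideal_prod A X Y \<subseteq> Z"
proof
  fix z assume "z \<in> ideal_prod A X Y"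
  then show "z \<in> Z"
    by induction (use assms in \<open>auto intro: additive_subgroup.a_closed\<close>)
qed

context nonassoc_ring
begin

lemma l_null [simp]: "x \<in> carrier R \<Longrightarrow> \<zero> \<otimes> x = \<zero>"
  using distrib_right[of \<zero> \<zero> x] by (simp add: mult_closed)

lemma l_minus: "\<lbrakk>x \<in> carrier R; y \<in> carrier R\<rbrakk> \<Longrightarrow> (\<ominus> x) \<otimes> y = \<ominus> (x \<otimes> y)"
  using distrib_right[of "\<ominus> x" x y] by (simp add: mult_closed l_neg minus_equality)

lemma additive_subgroup_if_closed:
  assumes "X \<subseteq> carrier R" "\<zero> \<in> X"
    and "\<And>x y. \<lbrakk>x \<in> X; y \<in> X\<rbrakk> \<Longrightarrow> x \<oplus> y \<in> X"
    and "\<And>x. x \<in> X \<Longrightarrow> \<ominus> x \<in> X"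
  shows "additive_subgroup X R"
  using assms by unfold_locales (auto simp: a_inv_def)

text \<open>Negatives are absorbed by the left factor, since -(xy) = (-x)y. This is why
  \<open>X\<close> has to be a subgroup, while \<open>Y\<close> may be any subset of the carrier
  containing zero.\<close>

lemma additive_subgroup_ideal_prod:
  assumes X: "additive_subgroup X R" and Y: "Y \<subseteq> carrier R" "\<zero> \<in> Y"
  shows "additive_subgroup (ideal_prod R X Y) R"
proof (rule additive_subgroup_if_closed)
  note Xc = additive_subgroup.a_subset[OF X]
  show carrier: "ideal_prod R X Y \<subseteq> carrier R"
  proof
    fix z assume "z \<in> ideal_prod R X Y"
    then show "z \<in> carrier R"
      by induction (use Xc Y in \<open>auto intro: mult_closed\<close>)
  qed
  \<comment> \<open>\<open>ideal_prod\<close> has no empty sum, so zero has to be exhibited as a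
    product.\<close>
  have "\<zero> \<otimes> \<zero> \<in> ideal_prod R X Y"
    by (rule ideal_prod.prod) (use Y additive_subgroup.zero_closed[OF X] in auto)
  then show "\<zero> \<in> ideal_prod R X Y" by simp
  show "\<ominus> z \<in> ideal_prod R X Y" if "z \<in> ideal_prod R X Y" for z
    using that
  proof induction
    case (prod x y)
    then have "(\<ominus> x) \<otimes> y \<in> ideal_prod R X Y"
      by (intro ideal_prod.prod additive_subgroup.a_inv_closed[OF X])
    moreover have "(\<ominus> x) \<otimes> y = \<ominus> (x \<otimes> y)"
      by (rule l_minus) (use prod Xc Y in auto)
    ultimately show ?case by simp
  next
    case (sum u v)
    then have "\<ominus> (u \<oplus> v) = \<ominus> u \<oplus> \<ominus> v"
      using carrier by (intro minus_add) auto
    then show ?case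
      using ideal_prod.sum[OF sum.IH] by simp
  qed
qed (rule ideal_prod.sum)

end

context nonassoc_ring_extension
begin

text \<open>Associativity enters as two equations between triple products, and the identity property
  is asked of \<open>I\<close> alone. In this form the hypotheses can be checked in the opposite
  ring by reversing products.\<close>

lemma trivial_if_invariant:
  assumes simple: "simple_nonassoc_ring A"
    and summand: "left_direct_summand A B B"
    and idem: "right_identity_property A B I"
    and inv: "invariant_ideal A B I"
    and assoc_right: "ideal_prod A (ideal_prod A I (carrier A)) (carrier A) =
      ideal_prod A I (ideal_prod A (carrier A) (carrier A))"
    and assoc_mid: "ideal_prod A (carrier A) (ideal_prod A I (carrier A)) =
      ideal_prod A (ideal_prod A (carrier A) I) (carrier A)"
  shows "I = {\<zero>} \<or> I = B"
proof -
  let ?IA = "ideal_prod A I (carrier A)"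
  from inv have I: "additive_subgroup I A" "I \<subseteq> B"
    and I_mult: "\<And>b x. b \<in> B \<Longrightarrow> x \<in> I \<Longrightarrow> x \<otimes> b \<in> I"
    and AI: "ideal_prod A (carrier A) I \<subseteq> ?IA"
    by (auto simp: invariant_ideal_def nonassoc_ideal_def)
  have B_carrier: "B \<subseteq> carrier A"
    by (rule additive_subgroup.a_subset[OF subring_additive])
  have carrier_subgroup: "additive_subgroup (carrier A) A"
    by (rule additive_subgroup_if_closed) auto
  have IA: "additive_subgroup ?IA A"
    by (rule additive_subgroup_ideal_prod) (use I in auto)
  have right: "ideal_prod A ?IA (carrier A) \<subseteq> ?IA"
    unfolding assoc_right
    by (intro ideal_prod_mono ideal_prod_subsetI carrier_subgroup mult_closed) auto
  have left: "ideal_prod A (carrier A) ?IA \<subseteq> ?IA"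
    unfolding assoc_mid using ideal_prod_mono[OF AI subset_refl] right by blast
  \<comment> \<open>Ideals are defined elementwise; a single product belongs to the product set, so
    the inclusions \<open>left\<close> and \<open>right\<close> suffice.\<close>
  have "nonassoc_ideal A (carrier A) ?IA"
    unfolding nonassoc_ideal_def
    using IA additive_subgroup.a_subset[OF IA] left right by (blast intro: ideal_prod.prod)
  then consider "?IA = {\<zero>}" | "?IA = carrier A"
    using simple by (auto simp: simple_nonassoc_ring_def)
  then show ?thesis
  proof cases
    case 1
    \<comment> \<open>The identity property enters here: I = IB lies in IA, so IA can vanish only
      together with I.\<close>
    have "I \<subseteq> ?IA"
      using ideal_prod_mono[OF subset_refl B_carrier, of A I] idem
      by (simp add: right_identity_property_def)
    then show ?thesis
      using 1 additive_subgroup.zero_closed[OF I(1)] by auto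
  next
    case 2
    from summand obtain C where C: "additive_subgroup C A"
      and C_mult: "\<And>b x. b \<in> B \<Longrightarrow> x \<in> C \<Longrightarrow> b \<otimes> x \<in> C"
      and int: "B \<inter> C = {\<zero>}" and sum: "B <+> C = carrier A"
      by (auto simp: left_direct_summand_def left_submodule_def)
    note I_carrier = additive_subgroup.a_subset[OF I(1)]
    note C_carrier = additive_subgroup.a_subset[OF C]
    have "?IA \<subseteq> I <+> C"
    proof
      fix z assume "z \<in> ?IA"
      then show "z \<in> I <+> C"
      proof induction
        case (prod x a)
        then obtain b c where a: "b \<in> B" "c \<in> C" "a = b \<oplus> c"
          using sum by (fastforce simp: set_add_def set_mult_def)
        \<comment> \<open>The two terms are controlled for different reasons: xb lies in I because I
          is an ideal of B, and xc lies in C because x is in B and C is a left B-module.\<close>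
        have "x \<otimes> a = x \<otimes> b \<oplus> x \<otimes> c"
          unfolding a(3)
          by (rule distrib_left) (use a prod I_carrier B_carrier C_carrier in auto)
        moreover have "x \<otimes> b \<in> I" "x \<otimes> c \<in> C"
          using prod a I(2) I_mult C_mult by auto
        ultimately show ?case
          by (auto simp: set_add_def set_mult_def)
      next
        case (sum u v)
        then obtain i c j d where ic: "i \<in> I" "c \<in> C" "u = i \<oplus> c"
          and jd: "j \<in> I" "d \<in> C" "v = j \<oplus> d"
          by (auto simp: set_add_def set_mult_def)
        then have "u \<oplus> v = (i \<oplus> j) \<oplus> (c \<oplus> d)"
          using I_carrier C_carrier by (simp add: subset_iff a_ac)
        moreover have "i \<oplus> j \<in> I" "c \<oplus> d \<in> C"
          using ic jd by (simp_all add: additive_subgroup.a_closed[OF I(1)] additive_subgroup.a_closed[OF C])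
        ultimately show ?case
          by (auto simp: set_add_def set_mult_def)
      qed
    qed
    have "B \<subseteq> I"
    proof
      fix b assume b: "b \<in> B"
      then have "b \<in> I <+> C"
        using 2 B_carrier \<open>?IA \<subseteq> I <+> C\<close> by auto
      then obtain i c where ic: "i \<in> I" "c \<in> C" "b = i \<oplus> c"
        by (auto simp: set_add_def set_mult_def)
      then have carr: "i \<in> carrier A" "c \<in> carrier A"
        using I_carrier C_carrier by auto
      \<comment> \<open>Since i and b both lie in B, so does c = b - i. Thus c is in the
        intersection of B and C, hence zero, and b = i.\<close>
      have "\<ominus> i \<oplus> b = c"
        using ic(3) carr by (simp add: r_neg1)
      moreover have "\<ominus> i \<oplus> b \<in> B"
        using ic(1) b I(2) additive_subgroup.a_closed[OF subring_additive]
          additive_subgroup.a_inv_closed[OF subring_additive] by auto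
      ultimately have "c = \<zero>"
        using ic(2) int by auto
      then show "b \<in> I"
        using ic carr by simp
    qed
    then show ?thesis using I(2) by auto
  qed
qed

end

text \<open>Only the multiplication field is updated, so carrier, zero and addition are literally
  those of \<open>A\<close>, and reversing twice gives back \<open>A\<close> itself.\<close>

definition opposite :: "('a, 'm) ring_scheme \<Rightarrow> ('a, 'm) ring_scheme" where
  "opposite A = A\<lparr>mult := \<lambda>x y. y \<otimes>\<^bsub>A\<^esub> x\<rparr>"

lemma opposite_simps [simp]:
  "carrier (opposite A) = carrier A"
  "x \<otimes>\<^bsub>opposite A\<^esub> y = y \<otimes>\<^bsub>A\<^esub> x"
  "\<zero>\<^bsub>opposite A\<^esub> = \<zero>\<^bsub>A\<^esub>"
  "add (opposite A) = add A"
  by (simp_all add: opposite_def)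

lemma additive_subgroup_opposite [simp]:
  "additive_subgroup X (opposite A) \<longleftrightarrow> additive_subgroup X A"
  by (simp add: additive_subgroup_def)

lemma set_add_opposite [simp]: "X <+>\<^bsub>opposite A\<^esub> Y = X <+>\<^bsub>A\<^esub> Y"
  by (simp add: set_add_def)

lemma ideal_prod_opposite_subset: "ideal_prod (opposite A) X Y \<subseteq> ideal_prod A Y X"
proof
  fix z assume "z \<in> ideal_prod (opposite A) X Y"
  then show "z \<in> ideal_prod A Y X"
    by induction (auto intro: ideal_prod.intros)
qed

text \<open>The converse inclusion is the previous lemma for \<open>opposite A\<close> with the
  factors exchanged, because \<open>opposite (opposite A)\<close> is \<open>A\<close>.\<close>

lemma ideal_prod_opposite [simp]: "ideal_prod (opposite A) X Y = ideal_prod A Y X"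
  using ideal_prod_opposite_subset[of A X Y] ideal_prod_opposite_subset[of "opposite A" Y X]
  by (simp add: opposite_def)

lemma nonassoc_ideal_opposite [simp]: "nonassoc_ideal (opposite A) B I \<longleftrightarrow> nonassoc_ideal A B I"
  by (auto simp: nonassoc_ideal_def)

lemma nonassoc_ring_extension_opposite:
  assumes "nonassoc_ring_extension A B"
  shows "nonassoc_ring_extension (opposite A) B"
proof -
  interpret nonassoc_ring_extension A B by (rule assms)
  have "abelian_group (opposite A)"
    using abelian_group_axioms
    by (simp add: abelian_group_def abelian_group_axioms_def abelian_monoid_def)
  \<comment> \<open>Reversal makes the two distributive laws change places.\<close>
  then show ?thesis
    by (simp add: nonassoc_ring_extension_def nonassoc_ring_extension_axioms_def nonassoc_ring_def
        nonassoc_ring_axioms_def mult_closed distrib_left distrib_right subring_additive subring_mult)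
qed

lemma ideal_associativeD:
  assumes "ideal_associative A B" "nonassoc_ideal A B I"
    and "factors s = replicate m (carrier A) @ [I] @ replicate n (carrier A)"
    and "factors t = replicate m (carrier A) @ [I] @ replicate n (carrier A)"
  shows "bracketing_prod A s = bracketing_prod A t"
  using assms unfolding ideal_associative_def by blast

text \<open>The first two equations are those that \<open>trivial_if_invariant\<close> asks of
  \<open>A\<close>. Applied to \<open>opposite A\<close>, where products are reversed, it asks for
  the last two.\<close>

lemma ideal_associative_triple:
  assumes "ideal_associative A B" "nonassoc_ideal A B I"
  shows "ideal_prod A (ideal_prod A I (carrier A)) (carrier A) =
      ideal_prod A I (ideal_prod A (carrier A) (carrier A))"
    and "ideal_prod A (ideal_prod A (carrier A) I) (carrier A) =
      ideal_prod A (carrier A) (ideal_prod A I (carrier A))"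
    and "ideal_prod A (ideal_prod A (carrier A) (carrier A)) I =
      ideal_prod A (carrier A) (ideal_prod A (carrier A) I)"
  \<comment> \<open>The pairs 0 2, 1 1 and 2 0 count the copies of \<open>carrier A\<close> before
    and after \<open>I\<close>. Rewriting 2 by successors lets \<open>replicate\<close>
    unfold.\<close>
  using ideal_associativeD[OF assms, of "Product (Product (Factor I) (Factor (carrier A))) (Factor (carrier A))"
      0 2 "Product (Factor I) (Product (Factor (carrier A)) (Factor (carrier A)))"]
    ideal_associativeD[OF assms, of "Product (Product (Factor (carrier A)) (Factor I)) (Factor (carrier A))"
      1 1 "Product (Factor (carrier A)) (Product (Factor I) (Factor (carrier A)))"]
    ideal_associativeD[OF assms, of "Product (Product (Factor (carrier A)) (Factor (carrier A))) (Factor I)"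
      2 0 "Product (Factor (carrier A)) (Product (Factor (carrier A)) (Factor I))"]
  by (simp_all add: numeral_2_eq_2)

theorem theorem1p3:
  fixes A :: "('a, 'm) ring_scheme" and B :: "'a set"
  assumes "nonassoc_ring_extension A B"
    and "ideal_associative A B"
    and "simple_nonassoc_ring A"
  shows
    "(left_direct_summand A B B \<and> (\<forall>I. nonassoc_ideal A B I \<longrightarrow> right_identity_property A B I)
        \<longrightarrow> extension_simple A B) \<and>
     (right_direct_summand A B B \<and> (\<forall>I. nonassoc_ideal A B I \<longrightarrow> left_identity_property A B I)
        \<longrightarrow> op_extension_simple A B)"
proof (intro conjI impI)
  assume hyps: "left_direct_summand A B B \<and>
    (\<forall>I. nonassoc_ideal A B I \<longrightarrow> right_identity_property A B I)"
  show "extension_simple A B"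
    unfolding extension_simple_def
  proof (intro allI impI)
    fix I assume inv: "invariant_ideal A B I"
    then have I: "nonassoc_ideal A B I" by (simp add: invariant_ideal_def)
    show "I = {\<zero>\<^bsub>A\<^esub>} \<or> I = B"
      using nonassoc_ring_extension.trivial_if_invariant[OF assms(1,3) _ _ inv] hyps I
        ideal_associative_triple[OF assms(2) I] by simp
  qed
next
  assume hyps: "right_direct_summand A B B \<and>
    (\<forall>I. nonassoc_ideal A B I \<longrightarrow> left_identity_property A B I)"
  show "op_extension_simple A B"
    unfolding op_extension_simple_def
  proof (intro allI impI)
    fix I assume inv: "op_invariant_ideal A B I"
    then have I: "nonassoc_ideal A B I" by (simp add: op_invariant_ideal_def)
    \<comment> \<open>Each hypothesis is now read in \<open>opposite A\<close>: two-sided ideals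
      stay the same, whereas left and right submodules, BI and IB, and the two inclusions between AI
      and IA change places.\<close>
    have "simple_nonassoc_ring (opposite A)"
      using assms(3) by (simp add: simple_nonassoc_ring_def)
    moreover have "left_direct_summand (opposite A) B B"
      using hyps by (simp add: left_direct_summand_def right_direct_summand_def
          left_submodule_def right_submodule_def)
    moreover have "right_identity_property (opposite A) B I"
      using hyps I by (simp add: right_identity_property_def left_identity_property_def)
    moreover have "invariant_ideal (opposite A) B I"
      using inv by (simp add: invariant_ideal_def op_invariant_ideal_def)
    ultimately show "I = {\<zero>\<^bsub>A\<^esub>} \<or> I = B"
      using nonassoc_ring_extension.trivial_if_invariant[OF
          nonassoc_ring_extension_opposite[OF assms(1)], of I]
        ideal_associative_triple[OF assms(2) I] by simp
  qed
qed

end
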